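(* Let $n\ge3$ and $\mathbf{char}(q)=\ell\ge3$. Then $(\Omega_q(n),d^\bullet)$ is a complex, i.e. $d^{s+1}d^s=0$ for $s=0,1,\dots,n$.
   Context: $k$ is an algebraically closed field of characteristic $0$ and $q\in k^*$, $q\ne\pm1$. $[a]=\frac{q^a-q^{-a}}{q-q^{-1}}$; $\mathbf{char}(q)$ is the smallest positive integer $\ell$ with $[\ell]=0$. $\mathcal A_q(n)$ is the $k$-vector space with basis $\{x^{(\alpha)}\mid\alpha\in\mathbb Z_+^n\}$ ($\mathbb Z_+$ = nonnegative integers); $x^{(\beta)}:=0$ if $\beta\notin\mathbb Z_+^n$; $\varepsilon_i$ is the $i$-th unit vector. For $\alpha,\beta\in\mathbb Z^n$, $\alpha*\beta=\sum_{j=1}^{n-1}\sum_{i>j}\alpha_i\beta_j$, so $\varepsilon_i*\alpha=\sum_{j<i}\alpha_j$. $\wedge_q(n)=k\{dx_1,\dots,dx_n\}/((dx_i)^2,\ dx_jdx_i+q^{-1}dx_idx_j\ (i<j))$ is the quantum exterior algebra, product written $\wedge$; $\wedge_q(n)_{(s)}$ is its degree $s$ part, with basis $dx_{i_1}\wedge\cdots\wedge dx_{i_s}$, $i_1<\cdots<i_s$ (zero for $s>n$). $\Omega_q(n)=\bigoplus_{s=0}^n\Omega_q(n)^{(s)}$, $\Omega_q(n)^{(s)}=\mathcal A_q(n)\otimes_k\wedge_q(n)_{(s)}$, and $d^s:\Omega_q(n)^{(s)}\to\Omega_q(n)^{(s+1)}$ is the linear map $$d^s(x^{(\alpha)}\otimes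 dx_{i_1}\wedge\cdots\wedge dx_{i_s})=\sum_{j=1}^nq^{-\varepsilon_j*\alpha}x^{(\alpha-\varepsilon_j)}\otimes dx_j\wedge dx_{i_1}\wedge\cdots\wedge dx_{i_s};$$ in particular $d^n=0$ (and $d^{n+1}=0$). *)

theory Defs
  imports
    "HOL-Library.Cardinality"
    "HOL-Library.Poly_Mapping"
    "HOL-Computational_Algebra.Polynomial"
    "HOL-Algebra.QuotRing"
begin

text \<open>
  The index set \<open>{1, \<dots>, n}\<close> is an arbitrary finite linearly ordered type \<open>'n\<close>, so
  \<open>n = CARD('n)\<close>.
\<close>

section \<open>Quantum integers\<close>

definition qint :: "'k::field \<Rightarrow> int \<Rightarrow> 'k" where
  "qint q a = (q powi a - q powi (- a)) / (q - inverse q)"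

text \<open>The value 0 says that no positive integer \<open>l\<close> satisfies \<open>[l] = 0\<close>.\<close>

definition qchar :: "'k::field \<Rightarrow> nat" where
  "qchar q = (if \<exists>l>0. qint q (int l) = 0 then LEAST l. l > 0 \<and> qint q (int l) = 0 else 0)"


section \<open>The quantum divided power space\<close>

definition unit_vec :: "'n \<Rightarrow> 'n \<Rightarrow> int" where
  "unit_vec i = (\<lambda>j. if j = i then 1 else 0)"

definition star :: "('n::{finite,linorder} \<Rightarrow> int) \<Rightarrow> ('n \<Rightarrow> int) \<Rightarrow> int" where
  "star \<alpha> \<beta> = (\<Sum>j\<in>UNIV. \<Sum>i\<in>{j<..}. \<alpha> i * \<beta> j)"

type_synonym ('n, 'k) divpow = "('n \<Rightarrow> nat) \<Rightarrow>\<^sub>0 'k"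

definition xdiv :: "('n \<Rightarrow> int) \<Rightarrow> ('n, 'k::field) divpow" where
  "xdiv \<alpha> = (if \<forall>i. 0 \<le> \<alpha> i then Poly_Mapping.single (\<lambda>i. nat (\<alpha> i)) 1 else 0)"


section \<open>The quantum exterior algebra\<close>

text \<open>
  Words under concatenation form the free monoid, written additively so that
  \<open>'n word \<Rightarrow>\<^sub>0 'k\<close>, with the convolution product of \<open>\<Rightarrow>\<^sub>0\<close>, is the free associative
  algebra on the letters \<open>'n\<close>.
\<close>

datatype 'n word = Word (letters: "'n list")

instantiation word :: (type) monoid_add
begin
definition zero_word :: "'a word" where "0 = Word []"
definition plus_word :: "'a word \<Rightarrow> 'a word \<Rightarrow> 'a word" where
  "u + v = Word (letters u @ letters v)"
instance by standard (auto simp: zero_word_def plus_word_def)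
end

type_synonym ('n, 'k) free_algebra = "'n word \<Rightarrow>\<^sub>0 'k"

definition free_alg :: "('n, 'k::field) free_algebra ring" where
  "free_alg = \<lparr>carrier = UNIV, mult = (*), one = 1, zero = 0, add = (+)\<rparr>"

definition gen :: "'n \<Rightarrow> ('n, 'k::field) free_algebra" where
  "gen i = Poly_Mapping.single (Word [i]) 1"

definition scalar :: "'k::field \<Rightarrow> ('n, 'k) free_algebra" where
  "scalar c = Poly_Mapping.single 0 c"

definition qext_ideal :: "'k::field \<Rightarrow> ('n::{finite,linorder}, 'k) free_algebra set" where
  "qext_ideal q = genideal free_alg
     ({gen i * gen i | i. True} \<union>
      {gen j * gen i + scalar (inverse q) * (gen i * gen j) | i j. i < j})"

definition qext :: "'k::field \<Rightarrow> ('n::{finite,linorder}, 'k) free_algebra set ring" where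
  "qext q = free_alg Quot qext_ideal q"

definition qext_class ::
    "'k::field \<Rightarrow> ('n::{finite,linorder}, 'k) free_algebra \<Rightarrow> ('n, 'k) free_algebra set" where
  "qext_class q p = qext_ideal q +>\<^bsub>free_alg\<^esub> p"

definition dx :: "'k::field \<Rightarrow> 'n::{finite,linorder} \<Rightarrow> ('n, 'k) free_algebra set" where
  "dx q i = qext_class q (gen i)"

definition qext_scale ::
    "'k::field \<Rightarrow> 'k \<Rightarrow> ('n::{finite,linorder}, 'k) free_algebra set \<Rightarrow> ('n, 'k) free_algebra set" where
  "qext_scale q c \<omega> = qext_class q (scalar c) \<otimes>\<^bsub>qext q\<^esub> \<omega>"

definition qext_deg :: "'k::field \<Rightarrow> nat \<Rightarrow> ('n::{finite,linorder}, 'k) free_algebra set set" where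
  "qext_deg q s = qext_class q ` {p. \<forall>w\<in>Poly_Mapping.keys p. length (letters w) = s}"


section \<open>The quantum de Rham complex\<close>

text \<open>
  Since the \<open>x\<^bsup>(\<alpha>)\<^esup>\<close> form a basis of the divided power space, its tensor product with a vector
  space \<open>V\<close> is the space of finitely supported families in \<open>V\<close> indexed by the exponents
  \<open>\<alpha>\<close>; the family \<open>f\<close> stands for the sum of all \<open>x\<^bsup>(\<alpha>)\<^esup> \<otimes> f \<alpha>\<close>.
\<close>

type_synonym ('n, 'k) form = "('n \<Rightarrow> nat) \<Rightarrow> ('n, 'k) free_algebra set"

definition form_supp :: "'k::field \<Rightarrow> ('n::{finite,linorder}, 'k) form \<Rightarrow> ('n \<Rightarrow> nat) set" where
  "form_supp q f = {\<alpha>. f \<alpha> \<noteq> \<zero>\<^bsub>qext q\<^esub>}"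

definition Omega :: "'k::field \<Rightarrow> nat \<Rightarrow> ('n::{finite,linorder}, 'k) form set" where
  "Omega q s = {f. (\<forall>\<alpha>. f \<alpha> \<in> qext_deg q s) \<and> finite (form_supp q f)}"

definition form_zero :: "'k::field \<Rightarrow> ('n::{finite,linorder}, 'k) form" where
  "form_zero q = (\<lambda>\<beta>. \<zero>\<^bsub>qext q\<^esub>)"

definition form_add ::
    "'k::field \<Rightarrow> ('n::{finite,linorder}, 'k) form \<Rightarrow> ('n, 'k) form \<Rightarrow> ('n, 'k) form" where
  "form_add q f g = (\<lambda>\<beta>. f \<beta> \<oplus>\<^bsub>qext q\<^esub> g \<beta>)"

definition form_scale ::
    "'k::field \<Rightarrow> 'k \<Rightarrow> ('n::{finite,linorder}, 'k) form \<Rightarrow> ('n, 'k) form" where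
  "form_scale q c f = (\<lambda>\<beta>. qext_scale q c (f \<beta>))"

definition form_sum ::
    "'k::field \<Rightarrow> ('i \<Rightarrow> ('n::{finite,linorder}, 'k) form) \<Rightarrow> 'i set \<Rightarrow> ('n, 'k) form" where
  "form_sum q F X = (\<lambda>\<beta>. finsum (qext q) (\<lambda>i. F i \<beta>) X)"

definition tensor ::
    "'k::field \<Rightarrow> ('n::{finite,linorder}, 'k) divpow \<Rightarrow> ('n, 'k) free_algebra set \<Rightarrow> ('n, 'k) form" where
  "tensor q a \<omega> = (\<lambda>\<beta>. qext_scale q (Poly_Mapping.lookup a \<beta>) \<omega>)"

definition d_mono ::
    "'k::field \<Rightarrow> ('n::{finite,linorder} \<Rightarrow> int) \<Rightarrow> ('n, 'k) free_algebra set \<Rightarrow> ('n, 'k) form" where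
  "d_mono q \<alpha> \<omega> = form_sum q (\<lambda>j.
     form_scale q (q powi (- star (unit_vec j) \<alpha>))
       (tensor q (xdiv (\<lambda>i. \<alpha> i - unit_vec j i)) (dx q j \<otimes>\<^bsub>qext q\<^esub> \<omega>))) UNIV"

text \<open>
  The linear extension of \<open>d_mono\<close>, with domain the forms of degree \<open>s\<close>; as usual for
  \<open>restrict\<close>, it is \<open>undefined\<close> elsewhere.
\<close>

definition qd :: "'k::field \<Rightarrow> nat \<Rightarrow> ('n::{finite,linorder}, 'k) form \<Rightarrow> ('n, 'k) form" where
  "qd q s = (\<lambda>f\<in>Omega q s. form_sum q (\<lambda>\<alpha>. d_mono q (\<lambda>i. int (\<alpha> i)) (f \<alpha>)) (form_supp q f))"

subsection \<open>Well-definedness\<close>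

lemma ring_free_alg: "ring (free_alg :: ('n, 'k::field) free_algebra ring)"
proof (rule ringI)
  show "abelian_group (free_alg :: ('n, 'k) free_algebra ring)"
  proof (rule abelian_groupI)
    fix x :: "('n, 'k) free_algebra"
    show "\<exists>y\<in>carrier free_alg. y \<oplus>\<^bsub>free_alg\<^esub> x = \<zero>\<^bsub>free_alg\<^esub>"
      by (rule bexI[of _ "- x"]) (auto simp: free_alg_def)
  qed (auto simp: free_alg_def algebra_simps)
  show "Group.monoid (free_alg :: ('n, 'k) free_algebra ring)"
    by (rule monoidI) (auto simp: free_alg_def algebra_simps)
qed (auto simp: free_alg_def algebra_simps)

lemma ideal_qext_ideal: "ideal (qext_ideal q) free_alg"
  unfolding qext_ideal_def by (rule ring.genideal_ideal[OF ring_free_alg]) (simp add: free_alg_def)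

lemma ring_qext: "ring (qext q)"
  unfolding qext_def by (rule ideal.quotient_is_ring[OF ideal_qext_ideal])

lemma qext_class_hom: "ring_hom_ring free_alg (qext q) (qext_class q)"
  using ideal.rcos_ring_hom_ring[OF ideal_qext_ideal, of q]
  by (simp add: qext_def qext_class_def[abs_def])

lemma qext_class_closed [simp]: "qext_class q p \<in> carrier (qext q)"
  and qext_class_mult: "qext_class q (a * b) = qext_class q a \<otimes>\<^bsub>qext q\<^esub> qext_class q b"
  and qext_class_add: "qext_class q (a + b) = qext_class q a \<oplus>\<^bsub>qext q\<^esub> qext_class q b"
  and qext_class_one: "qext_class q 1 = \<one>\<^bsub>qext q\<^esub>"
  and qext_class_zero: "qext_class q 0 = \<zero>\<^bsub>qext q\<^esub>"
proof -
  interpret h: ring_hom_ring free_alg "qext q" "qext_class q" by (rule qext_class_hom)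
  show "qext_class q p \<in> carrier (qext q)"
    using h.hom_closed[of p] by (simp add: free_alg_def)
  show "qext_class q (a * b) = qext_class q a \<otimes>\<^bsub>qext q\<^esub> qext_class q b"
    using h.hom_mult[of a b] by (simp add: free_alg_def)
  show "qext_class q (a + b) = qext_class q a \<oplus>\<^bsub>qext q\<^esub> qext_class q b"
    using h.hom_add[of a b] by (simp add: free_alg_def)
  show "qext_class q 1 = \<one>\<^bsub>qext q\<^esub>"
    using h.hom_one by (simp add: free_alg_def)
  show "qext_class q 0 = \<zero>\<^bsub>qext q\<^esub>"
    using h.hom_zero by (simp add: free_alg_def)
qed

lemma carrier_qextE:
  assumes "w \<in> carrier (qext q)"
  obtains p where "w = qext_class q p"
  using assms by (auto simp: qext_def qext_class_def FactRing_def A_RCOSETS_def' free_alg_def)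

lemma qext_class_eq_zero: "p \<in> qext_ideal q \<Longrightarrow> qext_class q p = \<zero>\<^bsub>qext q\<^esub>"
proof -
  interpret ideal "qext_ideal q" free_alg by (rule ideal_qext_ideal)
  show "p \<in> qext_ideal q \<Longrightarrow> qext_class q p = \<zero>\<^bsub>qext q\<^esub>"
    by (simp add: qext_class_def qext_def FactRing_def a_rcos_const)
qed

lemma dx_relations:
  shows "dx q i \<otimes>\<^bsub>qext q\<^esub> dx q i = \<zero>\<^bsub>qext q\<^esub>"
    and "i < j \<Longrightarrow> dx q j \<otimes>\<^bsub>qext q\<^esub> dx q i
           \<oplus>\<^bsub>qext q\<^esub> qext_scale q (inverse q) (dx q i \<otimes>\<^bsub>qext q\<^esub> dx q j) = \<zero>\<^bsub>qext q\<^esub>"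
proof -
  have "gen i * gen i \<in> qext_ideal q"
    unfolding qext_ideal_def
    by (rule ring.genideal_self[OF ring_free_alg, THEN subsetD]) (auto simp: free_alg_def)
  from qext_class_eq_zero[OF this] show "dx q i \<otimes>\<^bsub>qext q\<^esub> dx q i = \<zero>\<^bsub>qext q\<^esub>"
    by (simp add: dx_def qext_class_mult)
  assume "i < j"
  then have "gen j * gen i + scalar (inverse q) * (gen i * gen j) \<in> qext_ideal q"
    unfolding qext_ideal_def
    by (intro ring.genideal_self[OF ring_free_alg, THEN subsetD]) (auto simp: free_alg_def)
  from qext_class_eq_zero[OF this]
  show "dx q j \<otimes>\<^bsub>qext q\<^esub> dx q i
           \<oplus>\<^bsub>qext q\<^esub> qext_scale q (inverse q) (dx q i \<otimes>\<^bsub>qext q\<^esub> dx q j) = \<zero>\<^bsub>qext q\<^esub>"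
    by (simp add: dx_def qext_class_mult qext_class_add qext_scale_def)
qed

lemma scalar_commute: "scalar c * p = p * scalar c"
proof (induction p rule: update_induct)
  case const
  then show ?case by simp
next
  case (update f a b)
  have "Poly_Mapping.update a b f = f + Poly_Mapping.single a b"
    using update by (intro poly_mapping_eqI)
      (auto simp: lookup_add lookup_update lookup_single in_keys_iff when_def)
  then show ?case
    using update by (simp add: algebra_simps scalar_def mult_single)
qed

lemma scalar_mult: "scalar (a * b) = scalar a * scalar b"
  and scalar_add: "scalar (a + b) = scalar a + scalar b"
  and scalar_zero: "scalar 0 = 0" and scalar_one: "scalar 1 = 1"
  by (simp_all add: scalar_def mult_single single_add)

lemma qext_scale_class: "qext_scale q c (qext_class q p) = qext_class q (scalar c * p)"
  by (simp add: qext_scale_def qext_class_mult)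

lemma qext_scale_closed [simp]: "w \<in> carrier (qext q) \<Longrightarrow> qext_scale q c w \<in> carrier (qext q)"
  by (auto elim!: carrier_qextE simp: qext_scale_class)

lemma dx_closed [simp]: "dx q i \<in> carrier (qext q)"
  by (simp add: dx_def)

lemma qext_deg_carrier: "w \<in> qext_deg q s \<Longrightarrow> w \<in> carrier (qext q)"
  by (auto simp: qext_deg_def)

lemma qext_deg_zero: "\<zero>\<^bsub>qext q\<^esub> \<in> qext_deg q s"
  unfolding qext_deg_def by (rule image_eqI[of _ _ 0]) (auto simp: qext_class_zero)

lemma qext_deg_add:
  assumes "v \<in> qext_deg q s" "w \<in> qext_deg q s"
  shows "v \<oplus>\<^bsub>qext q\<^esub> w \<in> qext_deg q s"
proof -
  obtain a b where ab: "v = qext_class q a" "w = qext_class q b"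
    "\<forall>u\<in>Poly_Mapping.keys a. length (letters u) = s"
    "\<forall>u\<in>Poly_Mapping.keys b. length (letters u) = s"
    using assms by (auto simp: qext_deg_def)
  have "v \<oplus>\<^bsub>qext q\<^esub> w = qext_class q (a + b)"
    using ab by (simp add: qext_class_add)
  moreover have "\<forall>u\<in>Poly_Mapping.keys (a + b). length (letters u) = s"
    using ab keys_add[of a b] by blast
  ultimately show ?thesis
    by (auto simp: qext_deg_def)
qed

lemma qext_deg_mult:
  assumes "v \<in> qext_deg q s" "w \<in> qext_deg q t"
  shows "v \<otimes>\<^bsub>qext q\<^esub> w \<in> qext_deg q (s + t)"
proof -
  obtain a b where ab: "v = qext_class q a" "w = qext_class q b"
    "\<forall>u\<in>Poly_Mapping.keys a. length (letters u) = s"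
    "\<forall>u\<in>Poly_Mapping.keys b. length (letters u) = t"
    using assms by (auto simp: qext_deg_def)
  have "v \<otimes>\<^bsub>qext q\<^esub> w = qext_class q (a * b)"
    using ab by (simp add: qext_class_mult)
  moreover have "\<forall>u\<in>Poly_Mapping.keys (a * b). length (letters u) = s + t"
    using ab keys_mult[of a b] by (fastforce simp: plus_word_def)
  ultimately show ?thesis
    by (auto simp: qext_deg_def)
qed

lemma qext_deg_scale: "w \<in> qext_deg q s \<Longrightarrow> qext_scale q c w \<in> qext_deg q s"
  unfolding qext_scale_def
  by (rule qext_deg_mult[of _ _ 0, simplified])
     (auto simp: qext_deg_def scalar_def zero_word_def split: if_splits intro!: imageI)

lemma qext_deg_dx: "dx q i \<in> qext_deg q 1"
  by (auto simp: qext_deg_def dx_def gen_def intro!: imageI)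

lemma qext_deg_finsum: "(\<And>i. i \<in> X \<Longrightarrow> f i \<in> qext_deg q s) \<Longrightarrow> finsum (qext q) f X \<in> qext_deg q s"
proof (induction X rule: infinite_finite_induct)
  interpret ring "qext q" by (rule ring_qext)
  case (insert x F)
  then show ?case by (subst finsum_insert) (auto intro: qext_deg_carrier qext_deg_add)
next
  interpret ring "qext q" by (rule ring_qext)
  case empty
  then show ?case by (simp add: qext_deg_zero)
next
  interpret ring "qext q" by (rule ring_qext)
  case infinite
  then show ?case by (simp add: qext_deg_zero finsum_infinite)
qed

lemma qext_scale_add_right:
  "\<lbrakk>v \<in> carrier (qext q); w \<in> carrier (qext q)\<rbrakk> \<Longrightarrow>
   qext_scale q c (v \<oplus>\<^bsub>qext q\<^esub> w) = qext_scale q c v \<oplus>\<^bsub>qext q\<^esub> qext_scale q c w"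
  unfolding qext_scale_def by (rule ring.ring_simprules(23)[OF ring_qext]) auto

lemma qext_scale_scale:
  "w \<in> carrier (qext q) \<Longrightarrow> qext_scale q a (qext_scale q b w) = qext_scale q (a * b) w"
  by (auto elim!: carrier_qextE simp: qext_scale_class scalar_mult mult.assoc)

lemma qext_scale_mult_right:
  "\<lbrakk>v \<in> carrier (qext q); w \<in> carrier (qext q)\<rbrakk> \<Longrightarrow>
   v \<otimes>\<^bsub>qext q\<^esub> qext_scale q c w = qext_scale q c (v \<otimes>\<^bsub>qext q\<^esub> w)"
proof (elim carrier_qextE)
  fix a b assume "v = qext_class q a" "w = qext_class q b"
  moreover have "a * (scalar c * b) = scalar c * (a * b)"
    by (metis mult.assoc scalar_commute)
  ultimately show ?thesis
    by (simp add: qext_scale_class qext_class_mult[symmetric])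
qed

lemma qext_scale_zero [simp]: "qext_scale q c \<zero>\<^bsub>qext q\<^esub> = \<zero>\<^bsub>qext q\<^esub>"
  by (simp add: qext_class_zero[symmetric] qext_scale_class)

lemma qext_scale_0 [simp]: "w \<in> carrier (qext q) \<Longrightarrow> qext_scale q 0 w = \<zero>\<^bsub>qext q\<^esub>"
  by (auto elim!: carrier_qextE simp: qext_scale_class scalar_zero qext_class_zero)

lemma qext_scale_1 [simp]: "w \<in> carrier (qext q) \<Longrightarrow> qext_scale q 1 w = w"
  by (auto elim!: carrier_qextE simp: qext_scale_class scalar_one)

lemma qext_scale_finsum:
  assumes "\<And>i. i \<in> X \<Longrightarrow> f i \<in> carrier (qext q)"
  shows "qext_scale q c (finsum (qext q) f X) = finsum (qext q) (\<lambda>i. qext_scale q c (f i)) X"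
proof -
  interpret ring "qext q" by (rule ring_qext)
  show ?thesis
  proof (cases "finite X")
    case True
    then show ?thesis
      unfolding qext_scale_def using assms by (intro finsum_rdistr) auto
  qed (simp add: finsum_infinite)
qed

abbreviation d_coeff where
  "d_coeff q \<alpha> w j \<beta> \<equiv> qext_scale q (q powi (- star (unit_vec j) \<alpha>))
     (qext_scale q (Poly_Mapping.lookup (xdiv (\<lambda>i. \<alpha> i - unit_vec j i)) \<beta>) (dx q j \<otimes>\<^bsub>qext q\<^esub> w))"

lemma d_mono_apply: "d_mono q \<alpha> w \<beta> = finsum (qext q) (\<lambda>j. d_coeff q \<alpha> w j \<beta>) UNIV"
  by (simp add: d_mono_def form_sum_def form_scale_def tensor_def)

lemma d_coeff_closed: "w \<in> carrier (qext q) \<Longrightarrow> d_coeff q \<alpha> w j \<beta> \<in> carrier (qext q)"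
proof -
  interpret ring "qext q" by (rule ring_qext)
  show "w \<in> carrier (qext q) \<Longrightarrow> d_coeff q \<alpha> w j \<beta> \<in> carrier (qext q)" by simp
qed

lemma d_mono_closed: "w \<in> carrier (qext q) \<Longrightarrow> d_mono q \<alpha> w \<beta> \<in> carrier (qext q)"
proof -
  interpret ring "qext q" by (rule ring_qext)
  show "w \<in> carrier (qext q) \<Longrightarrow> d_mono q \<alpha> w \<beta> \<in> carrier (qext q)"
    unfolding d_mono_apply by (intro finsum_closed) (auto intro: d_coeff_closed)
qed

lemma d_mono_deg: "w \<in> qext_deg q s \<Longrightarrow> d_mono q \<alpha> w \<beta> \<in> qext_deg q (Suc s)"
  unfolding d_mono_apply
  by (intro qext_deg_finsum qext_deg_scale)
     (use qext_deg_mult[OF qext_deg_dx, of w q s] in auto)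

lemma d_mono_zero: "d_mono q \<alpha> \<zero>\<^bsub>qext q\<^esub> \<beta> = \<zero>\<^bsub>qext q\<^esub>"
proof -
  interpret ring "qext q" by (rule ring_qext)
  show ?thesis by (simp add: d_mono_apply finsum_zero)
qed

lemma d_mono_add:
  assumes "v \<in> carrier (qext q)" "w \<in> carrier (qext q)"
  shows "d_mono q \<alpha> (v \<oplus>\<^bsub>qext q\<^esub> w) \<beta> = d_mono q \<alpha> v \<beta> \<oplus>\<^bsub>qext q\<^esub> d_mono q \<alpha> w \<beta>"
proof -
  interpret ring "qext q" by (rule ring_qext)
  have "d_coeff q \<alpha> (v \<oplus>\<^bsub>qext q\<^esub> w) j \<beta> = d_coeff q \<alpha> v j \<beta> \<oplus>\<^bsub>qext q\<^esub> d_coeff q \<alpha> w j \<beta>" for j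
    using assms by (simp add: r_distr qext_scale_add_right)
  then show ?thesis
    unfolding d_mono_apply using assms by (simp add: finsum_addf Pi_def d_coeff_closed)
qed

lemma d_mono_scale:
  assumes "w \<in> carrier (qext q)"
  shows "d_mono q \<alpha> (qext_scale q c w) \<beta> = qext_scale q c (d_mono q \<alpha> w \<beta>)"
proof -
  interpret ring "qext q" by (rule ring_qext)
  have "d_coeff q \<alpha> (qext_scale q c w) j \<beta> = qext_scale q c (d_coeff q \<alpha> w j \<beta>)" for j
    using assms by (simp add: qext_scale_mult_right qext_scale_scale mult_ac)
  then show ?thesis
    unfolding d_mono_apply using assms by (simp add: qext_scale_finsum d_coeff_closed)
qed

lemma d_mono_supp:
  fixes q :: "'k::field"
  assumes w: "w \<in> carrier (qext q)"
  shows "{\<beta>. d_mono q \<alpha> w \<beta> \<noteq> \<zero>\<^bsub>qext q\<^esub>} \<subseteq> (\<lambda>j i. nat (\<alpha> i - unit_vec j i)) ` UNIV"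
proof (rule subsetI, rule ccontr)
  interpret ring "qext q" by (rule ring_qext)
  fix \<beta> assume b: "\<beta> \<in> {\<beta>. d_mono q \<alpha> w \<beta> \<noteq> \<zero>\<^bsub>qext q\<^esub>}"
    and "\<beta> \<notin> (\<lambda>j i. nat (\<alpha> i - unit_vec j i)) ` UNIV"
  then have "Poly_Mapping.lookup (xdiv (\<lambda>i. \<alpha> i - unit_vec j i)) \<beta> = (0 :: 'k)" for j
    by (auto simp: xdiv_def lookup_single when_def)
  then have "d_mono q \<alpha> w \<beta> = \<zero>\<^bsub>qext q\<^esub>"
    using w unfolding d_mono_apply by (intro add.finprod_one_eqI) simp
  with b show False by simp
qed

lemma qd_apply:
  assumes "f \<in> Omega q s" "finite X" "form_supp q f \<subseteq> X"
  shows "qd q s f \<beta> = finsum (qext q) (\<lambda>\<alpha>. d_mono q (\<lambda>i. int (\<alpha> i)) (f \<alpha>) \<beta>) X"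
proof -
  interpret ring "qext q" by (rule ring_qext)
  have "f \<alpha> \<in> carrier (qext q)" for \<alpha>
    using assms(1) by (auto simp: Omega_def intro: qext_deg_carrier)
  then have "finsum (qext q) (\<lambda>\<alpha>. d_mono q (\<lambda>i. int (\<alpha> i)) (f \<alpha>) \<beta>) (form_supp q f) =
      finsum (qext q) (\<lambda>\<alpha>. d_mono q (\<lambda>i. int (\<alpha> i)) (f \<alpha>) \<beta>) X"
    using assms by (intro add.finprod_mono_neutral_cong_left)
       (auto simp: form_supp_def d_mono_zero d_mono_closed)
  then show ?thesis
    using assms by (simp add: qd_def form_sum_def)
qed

lemma qd_closed: "qd q s \<in> Omega q s \<rightarrow> Omega q (Suc s)"
proof
  interpret ring "qext q" by (rule ring_qext)
  fix f :: "('a, 'b) form" assume f: "f \<in> Omega q s"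
  then have fin: "finite (form_supp q f)" and deg: "f \<alpha> \<in> qext_deg q s" for \<alpha>
    by (auto simp: Omega_def)
  note ap = qd_apply[OF f fin subset_refl]
  have "form_supp q (qd q s f) \<subseteq>
      (\<Union>\<alpha>\<in>form_supp q f. {\<beta>. d_mono q (\<lambda>i. int (\<alpha> i)) (f \<alpha>) \<beta> \<noteq> \<zero>\<^bsub>qext q\<^esub>})"
  proof (rule subsetI, rule ccontr)
    fix \<beta> assume "\<beta> \<in> form_supp q (qd q s f)"
      and "\<beta> \<notin> (\<Union>\<alpha>\<in>form_supp q f. {\<beta>. d_mono q (\<lambda>i. int (\<alpha> i)) (f \<alpha>) \<beta> \<noteq> \<zero>\<^bsub>qext q\<^esub>})"
    moreover from this have "qd q s f \<beta> = \<zero>\<^bsub>qext q\<^esub>"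
      unfolding ap by (intro add.finprod_one_eqI) simp
    ultimately show False
      by (simp add: form_supp_def)
  qed
  moreover have "finite {\<beta>. d_mono q (\<lambda>i. int (\<alpha> i)) (f \<alpha>) \<beta> \<noteq> \<zero>\<^bsub>qext q\<^esub>}" for \<alpha>
    by (rule finite_subset[OF d_mono_supp]) (auto intro: qext_deg_carrier[OF deg])
  ultimately have "finite (form_supp q (qd q s f))"
    using fin by (meson finite_UN finite_subset)
  then show "qd q s f \<in> Omega q (Suc s)"
    by (auto simp: Omega_def ap intro!: qext_deg_finsum d_mono_deg deg)
qed

lemma qd_add:
  assumes f: "f \<in> Omega q s" and g: "g \<in> Omega q s"
  shows "form_add q f g \<in> Omega q s"
    and "qd q s (form_add q f g) = form_add q (qd q s f) (qd q s g)"
proof -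
  interpret ring "qext q" by (rule ring_qext)
  let ?X = "form_supp q f \<union> form_supp q g"
  have fin: "finite ?X" and deg: "f \<alpha> \<in> qext_deg q s" "g \<alpha> \<in> qext_deg q s" for \<alpha>
    using f g by (auto simp: Omega_def)
  note car = deg[THEN qext_deg_carrier]
  have sub: "form_supp q (form_add q f g) \<subseteq> ?X"
    by (auto simp: form_supp_def form_add_def)
  show fg: "form_add q f g \<in> Omega q s"
    using finite_subset[OF sub fin] deg by (auto simp: Omega_def form_add_def intro: qext_deg_add)
  show "qd q s (form_add q f g) = form_add q (qd q s f) (qd q s g)"
    using qd_apply[OF fg fin sub] qd_apply[OF f fin] qd_apply[OF g fin] car
    by (simp add: fun_eq_iff form_add_def d_mono_add d_mono_closed finsum_addf Pi_def)
qed

lemma qd_scale: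
  assumes f: "f \<in> Omega q s"
  shows "form_scale q c f \<in> Omega q s"
    and "qd q s (form_scale q c f) = form_scale q c (qd q s f)"
proof -
  interpret ring "qext q" by (rule ring_qext)
  have fin: "finite (form_supp q f)" and deg: "f \<alpha> \<in> qext_deg q s" for \<alpha>
    using f by (auto simp: Omega_def)
  note car = deg[THEN qext_deg_carrier]
  have sub: "form_supp q (form_scale q c f) \<subseteq> form_supp q f"
    unfolding form_supp_def form_scale_def by (intro Collect_mono impI notI) simp
  show cf: "form_scale q c f \<in> Omega q s"
    using finite_subset[OF sub fin] deg by (auto simp: Omega_def form_scale_def intro: qext_deg_scale)
  show "qd q s (form_scale q c f) = form_scale q c (qd q s f)"
    using qd_apply[OF cf fin sub] qd_apply[OF f fin] car
    by (simp add: fun_eq_iff form_scale_def d_mono_scale d_mono_closed qext_scale_finsum)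
qed

lemma qd_tensor:
  fixes \<alpha> :: "'n::{finite,linorder} \<Rightarrow> nat"
  assumes w: "w \<in> qext_deg q s"
  defines "a \<equiv> \<lambda>i. int (\<alpha> i)"
  shows "tensor q (xdiv a) w \<in> Omega q s"
    and "qd q s (tensor q (xdiv a) w) = form_sum q (\<lambda>j.
           form_scale q (q powi (- star (unit_vec j) a))
             (tensor q (xdiv (\<lambda>i. a i - unit_vec j i)) (dx q j \<otimes>\<^bsub>qext q\<^esub> w))) UNIV"
proof -
  interpret ring "qext q" by (rule ring_qext)
  have t: "tensor q (xdiv a) w \<beta> = (if \<beta> = \<alpha> then w else \<zero>\<^bsub>qext q\<^esub>)" for \<beta>
    using qext_deg_carrier[OF w] by (auto simp: tensor_def xdiv_def a_def lookup_single when_def)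
  have sub: "form_supp q (tensor q (xdiv a) w) \<subseteq> {\<alpha>}"
    by (auto simp: form_supp_def t)
  show om: "tensor q (xdiv a) w \<in> Omega q s"
    using finite_subset[OF sub] w by (auto simp: Omega_def t qext_deg_zero)
  have "qd q s (tensor q (xdiv a) w) \<beta> = d_mono q a w \<beta>" for \<beta>
  proof -
    have "qd q s (tensor q (xdiv a) w) \<beta> =
        finsum (qext q) (\<lambda>\<alpha>'. d_mono q (\<lambda>i. int (\<alpha>' i)) (tensor q (xdiv a) w \<alpha>') \<beta>) {\<alpha>}"
      by (rule qd_apply[OF om _ sub]) simp
    also have "\<dots> = d_mono q a w \<beta>"
      using d_mono_closed[OF qext_deg_carrier[OF w], of a \<beta>]
      by (subst finsum_insert) (simp_all add: t a_def[symmetric])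
    finally show ?thesis .
  qed
  then have "qd q s (tensor q (xdiv a) w) = d_mono q a w"
    by (simp add: fun_eq_iff)
  then show "qd q s (tensor q (xdiv a) w) = form_sum q (\<lambda>j.
           form_scale q (q powi (- star (unit_vec j) a))
             (tensor q (xdiv (\<lambda>i. a i - unit_vec j i)) (dx q j \<otimes>\<^bsub>qext q\<^esub> w))) UNIV"
    by (simp add: d_mono_def)
qed

end

theory Submission
  imports Defs
begin

text \<open>
  Moving the index of the divided power, the coefficient of \<open>d f\<close> at \<open>\<beta>\<close> is
  \<open>\<Sum>\<^sub>j q\<^bsup>-\<epsilon>\<^sub>j * \<beta>\<^esup> dx\<^sub>j \<and> f (\<beta> + \<epsilon>\<^sub>j)\<close>. Hence \<open>d (d f)\<close> has at \<open>\<beta>\<close> the coefficient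
  \<open>\<Sum>\<^sub>j \<Sum>\<^sub>k q\<^bsup>-\<epsilon>\<^sub>j * \<beta> - \<epsilon>\<^sub>k * (\<beta> + \<epsilon>\<^sub>j)\<^esup> dx\<^sub>j \<and> dx\<^sub>k \<and> f (\<beta> + \<epsilon>\<^sub>j + \<epsilon>\<^sub>k)\<close>.
  As \<open>\<epsilon>\<^sub>k * \<epsilon>\<^sub>j\<close> is 1 for \<open>j < k\<close> and 0 otherwise, the terms \<open>(j, k)\<close> and \<open>(k, j)\<close> cancel
  by the relations of the quantum exterior algebra.
\<close>

lemma (in abelian_monoid) finsum_swap:
  assumes "finite A" and "finite B"
    and "\<And>i j. i \<in> A \<Longrightarrow> j \<in> B \<Longrightarrow> f i j \<in> carrier G"
  shows "(\<Oplus>i\<in>A. \<Oplus>j\<in>B. f i j) = (\<Oplus>j\<in>B. \<Oplus>i\<in>A. f i j)"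
  using assms(1,3)
proof (induction A rule: finite_induct)
  case empty
  then show ?case by simp
next
  case (insert x A)
  have "(\<Oplus>i\<in>insert x A. \<Oplus>j\<in>B. f i j) = (\<Oplus>j\<in>B. f x j \<oplus> (\<Oplus>i\<in>A. f i j))"
    using insert by (simp add: Pi_def finsum_addf)
  also have "\<dots> = (\<Oplus>j\<in>B. \<Oplus>i\<in>insert x A. f i j)"
    using insert by (intro finsum_cong') auto
  finally show ?case .
qed

text \<open>By induction on \<open>A\<close>: a new index \<open>x\<close> adds the diagonal entry
  \<open>f x x\<close>, which vanishes, and one row and one column, which cancel entry by
  entry.\<close>

lemma (in abelian_monoid) finsum_alternating:
  assumes "finite A"
    and "\<And>i j. i \<in> A \<Longrightarrow> j \<in> A \<Longrightarrow> f i j \<in> carrier G"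
    and "\<And>i. i \<in> A \<Longrightarrow> f i i = \<zero>"
    and "\<And>i j. i \<in> A \<Longrightarrow> j \<in> A \<Longrightarrow> i \<noteq> j \<Longrightarrow> f i j \<oplus> f j i = \<zero>"
  shows "(\<Oplus>i\<in>A. \<Oplus>j\<in>A. f i j) = \<zero>"
  using assms
proof (induction A rule: finite_induct)
  case empty
  then show ?case by simp
next
  case (insert x A)
  have "(\<Oplus>i\<in>insert x A. \<Oplus>j\<in>insert x A. f i j) =
      (\<Oplus>j\<in>A. f x j) \<oplus> (\<Oplus>i\<in>A. \<Oplus>j\<in>insert x A. f i j)"
    using insert by (simp add: Pi_def)
  also have "(\<Oplus>i\<in>A. \<Oplus>j\<in>insert x A. f i j) = (\<Oplus>i\<in>A. f i x \<oplus> (\<Oplus>j\<in>A. f i j))"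
    using insert by (intro finsum_cong') auto
  also have "\<dots> = (\<Oplus>i\<in>A. f i x) \<oplus> (\<Oplus>i\<in>A. \<Oplus>j\<in>A. f i j)"
    using insert by (simp add: Pi_def finsum_addf)
  also have "(\<Oplus>i\<in>A. \<Oplus>j\<in>A. f i j) = \<zero>"
    using insert by simp
  \<comment> \<open>Row and column of \<open>x\<close> are merged into one sum of transposed
    pairs.\<close>
  also have "(\<Oplus>j\<in>A. f x j) \<oplus> ((\<Oplus>i\<in>A. f i x) \<oplus> \<zero>) = (\<Oplus>j\<in>A. f x j \<oplus> f j x)"
    using insert.prems by (simp add: Pi_def finsum_addf)
  also have "\<dots> = (\<Oplus>j\<in>A. \<zero>)"
  proof (intro finsum_cong')
    fix j assume "j \<in> A"
    moreover from this have "x \<noteq> j"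
      using insert.hyps by blast
    ultimately show "f x j \<oplus> f j x = \<zero>"
      using insert.prems by blast
  qed auto
  finally show ?case by simp
qed

lemma star_unit_vec: "star (unit_vec i) \<beta> = (\<Sum>j\<in>{..<i}. \<beta> j)"
proof -
  have "(\<Sum>k\<in>{j<..}. unit_vec i k * \<beta> j) = (if j \<in> {..<i} then \<beta> j else 0)" for j
    by (auto simp: unit_vec_def if_distrib[of "\<lambda>x. x * _"] sum.delta cong: if_cong)
  then show ?thesis
    by (simp add: star_def sum.If_cases lessThan_def)
qed

text \<open>This is \<beta> + \<open>\<epsilon>\<^sub>j\<close>, kept in the natural numbers so that
  it can index the coefficients of a form.\<close>

definition incr :: "('n \<Rightarrow> nat) \<Rightarrow> 'n \<Rightarrow> 'n \<Rightarrow> nat" where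
  "incr \<beta> j = \<beta>(j := Suc (\<beta> j))"

lemma incr_commute: "incr (incr \<beta> j) k = incr (incr \<beta> k) j"
  by (auto simp: incr_def fun_eq_iff)

text \<open>Only indices below \<open>k\<close> count in \<open>star (unit_vec k)\<close>. The
  resulting 1 for \<open>j < k\<close> supplies the factor \<open>inverse q\<close> of the exterior
  relation.\<close>

lemma star_incr:
  "star (unit_vec k) (\<lambda>i. int (incr \<beta> j i)) =
     star (unit_vec k) (\<lambda>i. int (\<beta> i)) + (if j < k then 1 else 0)"
proof -
  have "int (incr \<beta> j i) = int (\<beta> i) + (if i = j then 1 else 0)" for i
    by (simp add: incr_def)
  then show ?thesis
    by (simp add: star_unit_vec sum.distrib sum.delta)
qed

lemma lookup_xdiv_decr:
  "Poly_Mapping.lookup (xdiv (\<lambda>i. int (\<alpha> i) - unit_vec j i)) \<beta> =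
     (if \<alpha> = incr \<beta> j then 1 else 0)"
\<comment> \<open>Here \<open>nat\<close> would truncate the exponent -1 to 0, so this case rests on
  the convention that \<open>xdiv\<close> vanishes at negative exponents.\<close>
proof (cases "\<alpha> j = 0")
  case True
  then have "\<not> (\<forall>i. 0 \<le> int (\<alpha> i) - unit_vec j i)"
    by (auto simp: unit_vec_def intro: exI[of _ j])
  moreover have "\<alpha> \<noteq> incr \<beta> j"
    using True by (auto simp: incr_def)
  ultimately show ?thesis
    by (simp only: xdiv_def if_False lookup_zero)
next
  case False
  have "(\<lambda>i. nat (int (\<alpha> i) - unit_vec j i)) = \<beta> \<longleftrightarrow> \<alpha> = incr \<beta> j"
    using False by (auto simp: unit_vec_def incr_def fun_eq_iff)
  then show ?thesis
    using False by (auto simp: xdiv_def lookup_single when_def unit_vec_def)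
qed

text \<open>For fixed \<beta> and \<open>j\<close>, only the monomial with exponent
  \<open>incr \<beta> j\<close> is lowered to \<beta>. Once the two sums are swapped, the sum over
  exponents collapses to this term.\<close>

lemma qd_coeff:
  fixes q :: "'k::field" and f :: "('n::{finite,linorder}, 'k) form"
  assumes f: "f \<in> Omega q s"
  shows "qd q s f \<beta> = finsum (qext q)
    (\<lambda>j. qext_scale q (q powi (- star (unit_vec j) (\<lambda>i. int (\<beta> i))))
           (dx q j \<otimes>\<^bsub>qext q\<^esub> f (incr \<beta> j))) UNIV"
proof -
  interpret ring "qext q" by (rule ring_qext)
  \<comment> \<open>All \<open>incr \<beta> j\<close> are adjoined to the support, so that for each
    \<open>j\<close> the sum over \<open>X\<close> contains its only possibly nonzero term.\<close>
  define X where "X = form_supp q f \<union> range (incr \<beta>)"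
  define t where "t \<alpha> j = qext_scale q (q powi (- star (unit_vec j) (\<lambda>i. int (\<alpha> i))))
    (dx q j \<otimes>\<^bsub>qext q\<^esub> f \<alpha>)" for \<alpha> j
  have car [simp]: "f \<alpha> \<in> carrier (qext q)" for \<alpha>
    using f by (auto simp: Omega_def intro: qext_deg_carrier)
  have t_car [simp]: "t \<alpha> j \<in> carrier (qext q)" for \<alpha> j
    by (simp add: t_def)
  have X: "finite X" "form_supp q f \<subseteq> X" "incr \<beta> j \<in> X" for j
    using f by (auto simp: X_def Omega_def)
  have "qd q s f \<beta> = finsum (qext q) (\<lambda>\<alpha>. finsum (qext q)
      (\<lambda>j. if incr \<beta> j = \<alpha> then t \<alpha> j else \<zero>\<^bsub>qext q\<^esub>) UNIV) X"
    unfolding qd_apply[OF f X(1,2)] d_mono_apply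
    by (intro finsum_cong') (auto simp: lookup_xdiv_decr t_def intro!: finsum_cong')
  also have "\<dots> = finsum (qext q) (\<lambda>j. finsum (qext q)
      (\<lambda>\<alpha>. if incr \<beta> j = \<alpha> then t \<alpha> j else \<zero>\<^bsub>qext q\<^esub>) X) UNIV"
    by (rule finsum_swap) (auto simp: X)
  also have "\<dots> = finsum (qext q) (\<lambda>j. t (incr \<beta> j) j) UNIV"
    using X by (intro finsum_cong' finsum_singleton) auto
  \<comment> \<open>The power of \<open>q\<close> may be taken at \<beta> instead of
    \<open>incr \<beta> j\<close>: by \<open>star_incr\<close> with \<open>k = j\<close>, the shift
    is 0.\<close>
  finally show ?thesis
    by (simp add: t_def star_incr)
qed

lemma qext_scale_mult_left:
  assumes "v \<in> carrier (qext q)" and "w \<in> carrier (qext q)"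
  shows "qext_scale q c v \<otimes>\<^bsub>qext q\<^esub> w = qext_scale q c (v \<otimes>\<^bsub>qext q\<^esub> w)"
proof -
  interpret ring "qext q" by (rule ring_qext)
  show ?thesis
    using assms by (simp add: qext_scale_def m_assoc)
qed

lemma dx_dx_mult:
  assumes w: "w \<in> carrier (qext q)"
  shows "dx q i \<otimes>\<^bsub>qext q\<^esub> (dx q i \<otimes>\<^bsub>qext q\<^esub> w) = \<zero>\<^bsub>qext q\<^esub>"
    and "i < j \<Longrightarrow>
      dx q j \<otimes>\<^bsub>qext q\<^esub> (dx q i \<otimes>\<^bsub>qext q\<^esub> w) \<oplus>\<^bsub>qext q\<^esub>
      qext_scale q (inverse q) (dx q i \<otimes>\<^bsub>qext q\<^esub> (dx q j \<otimes>\<^bsub>qext q\<^esub> w)) = \<zero>\<^bsub>qext q\<^esub>"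
proof -
  interpret ring "qext q" by (rule ring_qext)
  show "dx q i \<otimes>\<^bsub>qext q\<^esub> (dx q i \<otimes>\<^bsub>qext q\<^esub> w) = \<zero>\<^bsub>qext q\<^esub>"
    using w dx_relations(1)[of q i] by (simp add: m_assoc[symmetric])
  assume "i < j"
  have "dx q j \<otimes>\<^bsub>qext q\<^esub> (dx q i \<otimes>\<^bsub>qext q\<^esub> w) \<oplus>\<^bsub>qext q\<^esub>
      qext_scale q (inverse q) (dx q i \<otimes>\<^bsub>qext q\<^esub> (dx q j \<otimes>\<^bsub>qext q\<^esub> w)) =
    (dx q j \<otimes>\<^bsub>qext q\<^esub> dx q i \<oplus>\<^bsub>qext q\<^esub>
      qext_scale q (inverse q) (dx q i \<otimes>\<^bsub>qext q\<^esub> dx q j)) \<otimes>\<^bsub>qext q\<^esub> w"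
    using w by (simp add: l_distr qext_scale_mult_left m_assoc)
  also have "\<dots> = \<zero>\<^bsub>qext q\<^esub>"
    using w dx_relations(2)[OF \<open>i < j\<close>, of q] by simp
  finally show "dx q j \<otimes>\<^bsub>qext q\<^esub> (dx q i \<otimes>\<^bsub>qext q\<^esub> w) \<oplus>\<^bsub>qext q\<^esub>
      qext_scale q (inverse q) (dx q i \<otimes>\<^bsub>qext q\<^esub> (dx q j \<otimes>\<^bsub>qext q\<^esub> w)) = \<zero>\<^bsub>qext q\<^esub>" .
qed

lemma qd_qd:
  fixes q :: "'k::field" and f :: "('n::{finite,linorder}, 'k) form"
  assumes q: "q \<noteq> 0" and f: "f \<in> Omega q s"
  shows "qd q (Suc s) (qd q s f) = form_zero q"
proof
  fix \<beta> :: "'n \<Rightarrow> nat"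
  interpret ring "qext q" by (rule ring_qext)
  have car [simp]: "f \<alpha> \<in> carrier (qext q)" for \<alpha>
    using f by (auto simp: Omega_def intro: qext_deg_carrier)
  define e where "e j = - star (unit_vec j) (\<lambda>i. int (\<beta> i))" for j
  define w where "w j k = f (incr (incr \<beta> j) k)" for j k
  \<comment> \<open>The outer differential at \<beta> contributes \<open>e j\<close>, the inner one
    at \<open>incr \<beta> j\<close> the rest of the exponent.\<close>
  define T where "T j k = qext_scale q (q powi (e j + e k - (if j < k then 1 else 0)))
    (dx q j \<otimes>\<^bsub>qext q\<^esub> (dx q k \<otimes>\<^bsub>qext q\<^esub> w j k))" for j k
  have w_car [simp]: "w j k \<in> carrier (qext q)" for j k
    by (simp add: w_def)
  have "qd q s f \<in> Omega q (Suc s)"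
    using f qd_closed by blast
  then have "qd q (Suc s) (qd q s f) \<beta> = finsum (qext q) (\<lambda>j. qext_scale q (q powi e j)
      (dx q j \<otimes>\<^bsub>qext q\<^esub> qd q s f (incr \<beta> j))) UNIV"
    by (simp add: qd_coeff e_def)
  also have "\<dots> = finsum (qext q) (\<lambda>j. finsum (qext q) (T j) UNIV) UNIV"
  proof (intro finsum_cong')
    fix j :: 'n
    have exponent: "- star (unit_vec k) (\<lambda>i. int (incr \<beta> j i)) =
        e k - (if j < k then 1 else 0)" for k
      by (simp add: star_incr e_def)
    show "qext_scale q (q powi e j) (dx q j \<otimes>\<^bsub>qext q\<^esub> qd q s f (incr \<beta> j)) =
        finsum (qext q) (T j) UNIV"
      \<comment> \<open>The scalars of the inner sum move past \<open>dx q j\<close>, and the powers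
        of \<open>q\<close> combine because \<open>q\<close> is nonzero.\<close>
      unfolding qd_coeff[OF f] exponent
      by (subst finsum_rdistr)
        (simp_all add: Pi_def qext_scale_finsum qext_scale_mult_right qext_scale_scale
          T_def[abs_def] w_def power_int_add[OF disjI1[OF q], symmetric] add_diff_eq)
  qed (auto simp: T_def)
  also have "\<dots> = \<zero>\<^bsub>qext q\<^esub>"
  proof (rule finsum_alternating)
    \<comment> \<open>Both terms carry the same \<open>w j k\<close>, since increments commute.
      Factoring out \<open>q powi (e k + e j)\<close> leaves exactly the relation for
      \<open>j < k\<close>, applied to \<open>w j k\<close>.\<close>
    have cancel: "T k j \<oplus>\<^bsub>qext q\<^esub> T j k = \<zero>\<^bsub>qext q\<^esub>" if "j < k" for j k
    proof -
      have "q powi (e j + e k - 1) = q powi (e k + e j) * inverse q"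
        using q by (simp add: power_int_diff field_simps)
      then have "T k j \<oplus>\<^bsub>qext q\<^esub> T j k = qext_scale q (q powi (e k + e j))
          (dx q k \<otimes>\<^bsub>qext q\<^esub> (dx q j \<otimes>\<^bsub>qext q\<^esub> w j k) \<oplus>\<^bsub>qext q\<^esub>
           qext_scale q (inverse q) (dx q j \<otimes>\<^bsub>qext q\<^esub> (dx q k \<otimes>\<^bsub>qext q\<^esub> w j k)))"
        using that less_not_sym[OF that]
        by (simp add: T_def w_def incr_commute[of \<beta> k j] qext_scale_add_right qext_scale_scale)
      then show ?thesis
        using that by (simp add: dx_dx_mult(2))
    qed
    fix j k :: 'n
    show "T j j = \<zero>\<^bsub>qext q\<^esub>"
      by (simp add: T_def dx_dx_mult(1))
    assume "j \<noteq> k"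
    then show "T j k \<oplus>\<^bsub>qext q\<^esub> T k j = \<zero>\<^bsub>qext q\<^esub>"
      using cancel[of j k] cancel[of k j] a_comm[of "T j k" "T k j"]
      by (cases j k rule: linorder_cases) (auto simp: T_def)
  qed (auto simp: T_def)
  finally show "qd q (Suc s) (qd q s f) \<beta> = form_zero q \<beta>"
    by (simp add: form_zero_def)
qed

theorem proposition4p4:
  fixes q :: "'k::{alg_closed_field,field_char_0}" and l :: nat
  assumes "q \<noteq> 0" and "q \<noteq> 1" and "q \<noteq> -1"
    and "CARD('n::{finite,linorder}) \<ge> 3"
    and "qchar q = l" and "l \<ge> 3"
  shows "\<forall>s\<le>CARD('n). \<forall>\<omega> \<in> (Omega q s :: ('n, 'k) form set).
           qd q (s + 1) (qd q s \<omega>) = form_zero q"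
  by (simp add: qd_qd[OF assms(1)])

end
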